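(* Let $m\in\mathbb{Z}$, $\alpha\in\mathbb{R}$, and let $P:\mathbb{R}\to\mathbb{R}$ be a piecewise $C^1$ payoff with $P_\alpha(y):=e^{-\alpha y}P(y)\in L^1(\mathbb{R})$. Suppose that, with $r=2^m\pi$ and for some integer $N\ge0$, $\hat P_\alpha\in C^{N+1}(\{|u|>r\})$, $\lim_{|u|\to\infty}\hat P_\alpha^{(j)}(u)=0$ for $0\le j\le N$, and $\hat P_\alpha^{(N+1)}\in L^1(\{|u|>r\})$. Let $y_k:=k/2^m$. Then, if $k\in\mathbb{Z}\setminus\{0\}$ and $y_k$ is not a jump point of $P$, up to a negligible $O(y_k^{-2})$ term, $$|V^\alpha_{m,k}|\le2^{-m/2}\left(|P_\alpha(y_k)|+\varepsilon_V(m)\,|y_k|^{-1}\right),$$ where $\varepsilon_V(m)=\frac1\pi|\operatorname{Im}[\hat P_\alpha(2^m\pi)]|=\frac1\pi|\operatorname{Im}[\hat P(2^m\pi-\mathrm{i}\alpha)]|$.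
   Context: The Fourier transform is $\hat h(z)=\int_{\mathbb{R}}h(y)e^{-\mathrm{i}zy}\,dy$, so $\hat P_\alpha(u)=\hat P(u-\mathrm{i}\alpha)$. The payoff coefficients are $$V^\alpha_{m,k}=\int_{\mathbb{R}}P_\alpha(y)\phi_{m,k}(y)\,dy=\frac{2^{-m/2}}{2\pi}\int_{-2^m\pi}^{2^m\pi}\hat P_\alpha(u)e^{\mathrm{i}ku/2^m}\,du,\qquad \phi_{m,k}(y)=2^{m/2}\operatorname{sinc}(2^my-k),\ \operatorname{sinc}(x)=\tfrac{\sin\pi x}{\pi x}.$$ A property holds piecewise if there is a finite partition of $\mathbb{R}$ into intervals on each of which it holds. Throughout, the payoff is defined on all of $\mathbb{R}$, may jump with uniformly bounded jump sizes, and has finitely many critical points.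
   Formalization: For N = 0 the O(y_k^{-2}) claim is false as stated, so the O(y_k^{-2}) term is proved for N ≥ 1 only; for every N ≥ 0, including N = 0, the same inequality is proved with an o(|y_k|^{-1}) term instead. *)

theory Defs
  imports "HOL-Analysis.Analysis" "HOL-Library.Landau_Symbols" "HOL-Library.Disjoint_Sets"
begin

definition fourier :: "(real \<Rightarrow> real) \<Rightarrow> complex \<Rightarrow> complex" where
  "fourier h z = (LINT y|lborel. complex_of_real (h y) * exp (- (\<i> * z * complex_of_real y)))"

definition damped :: "real \<Rightarrow> (real \<Rightarrow> real) \<Rightarrow> real \<Rightarrow> real" where
  "damped \<alpha> P y = exp (- \<alpha> * y) * P y"

definition damped_hat :: "real \<Rightarrow> (real \<Rightarrow> real) \<Rightarrow> real \<Rightarrow> complex" where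
  "damped_hat \<alpha> P u = fourier (damped \<alpha> P) (complex_of_real u)"

text \<open>The normalised sinc function (with \<open>\<pi>\<close> in the argument), continuously extended to 0.\<close>

definition nsinc :: "real \<Rightarrow> real" where
  "nsinc x = (if x = 0 then 1 else sin (pi * x) / (pi * x))"

definition shannon :: "int \<Rightarrow> int \<Rightarrow> real \<Rightarrow> real" where
  "shannon m k y = 2 powr (of_int m / 2) * nsinc (2 powr of_int m * y - of_int k)"

definition payoff_coeff :: "real \<Rightarrow> (real \<Rightarrow> real) \<Rightarrow> int \<Rightarrow> int \<Rightarrow> real" where
  "payoff_coeff \<alpha> P m k = (LINT y|lborel. damped \<alpha> P y * shannon m k y)"

definition grid :: "int \<Rightarrow> int \<Rightarrow> real" where
  "grid m k = of_int k / 2 powr of_int m"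

definition eps_V :: "real \<Rightarrow> (real \<Rightarrow> real) \<Rightarrow> int \<Rightarrow> real" where
  "eps_V \<alpha> P m = \<bar>Im (damped_hat \<alpha> P (2 powr of_int m * pi))\<bar> / pi"

text \<open>
  At an endpoint belonging to the interval \<open>I\<close> the derivative is one-sided, so \<open>f\<close> may jump
  there. This is why the library's \<open>piecewise_C1_differentiable_on\<close>, which
  requires continuity across the pieces, is not used.
\<close>

definition C1_on_interval :: "(real \<Rightarrow> real) \<Rightarrow> real set \<Rightarrow> bool" where
  "C1_on_interval f I \<longleftrightarrow>
     (\<exists>D. (\<forall>x\<in>I. (f has_real_derivative D x) (at x within I)) \<and> continuous_on I D)"

definition piecewise_on_line :: "(real set \<Rightarrow> bool) \<Rightarrow> bool" where
  "piecewise_on_line Q \<longleftrightarrow>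
     (\<exists>\<I>. finite \<I> \<and> partition_on UNIV \<I> \<and> (\<forall>I\<in>\<I>. is_interval I \<and> Q I))"

text \<open>
  Every discontinuity counts as a jump point, including one at which the two one-sided limits
  agree but differ from the value of the function.
\<close>

definition jump_point :: "(real \<Rightarrow> real) \<Rightarrow> real \<Rightarrow> bool" where
  "jump_point f y \<longleftrightarrow> \<not> isCont f y"

definition bounded_jumps :: "(real \<Rightarrow> real) \<Rightarrow> bool" where
  "bounded_jumps f \<longleftrightarrow>
     (\<exists>B. \<forall>y. jump_point f y \<longrightarrow>
        (\<exists>l r. (f \<longlongrightarrow> l) (at_left y) \<and> (f \<longlongrightarrow> r) (at_right y) \<and> \<bar>r - l\<bar> \<le> B))"

definition critical_point :: "(real \<Rightarrow> real) \<Rightarrow> real \<Rightarrow> bool" where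
  "critical_point f y \<longleftrightarrow> \<not> f differentiable (at y) \<or> deriv f y = 0"

definition admissible_payoff :: "(real \<Rightarrow> real) \<Rightarrow> bool" where
  "admissible_payoff P \<longleftrightarrow>
     piecewise_on_line (C1_on_interval P) \<and> bounded_jumps P \<and> finite {y. critical_point P y}"

definition nth_deriv :: "nat \<Rightarrow> (real \<Rightarrow> complex) \<Rightarrow> real \<Rightarrow> complex" where
  "nth_deriv n f = ((\<lambda>g u. vector_derivative g (at u)) ^^ n) f"

text \<open>Only meant for open sets \<open>S\<close>, on which iterating the two-sided derivative is harmless.\<close>

definition Ck_on :: "nat \<Rightarrow> (real \<Rightarrow> complex) \<Rightarrow> real set \<Rightarrow> bool" where
  "Ck_on n f S \<longleftrightarrow>
     (\<forall>j<n. \<forall>u\<in>S. nth_deriv j f differentiable (at u)) \<and> continuous_on S (nth_deriv n f)"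

end

theory Submission
  imports Defs "HOL-Real_Asymp.Real_Asymp"
begin

text \<open>
  Let \<open>f\<close> be the damped payoff, \<open>F\<close> its Fourier transform and \<open>y\<close> a grid point. Up to a
  factor, the payoff coefficient is the Fourier inversion integral of \<open>F\<close> at \<open>y\<close>, truncated to
  \<open>[-r, r]\<close>; as \<open>f\<close> is real, this is twice the real part of the integral over \<open>[0, r]\<close>.
  Integration by parts shows that the full inversion integral converges, and a convergent inversion integral has the right value at every continuity point: convergence implies
  Abel summability, and the Abel means are Poisson integrals of \<open>f\<close>. Hence the coefficient differs
  from \<open>f(y)\<close> only by the tail over \<open>\<bar>u\<bar> > r\<close>. Because \<open>r y\<close> is an integer multiple of \<open>\<pi>\<close>,
  the boundary term of one integration by parts is exactly
  \<open>\<plusminus> Im F(r) / (\<pi> y)\<close>. What remains is \<open>1 / y\<close> times an oscillatory integral of \<open>F'\<close>, which is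
  \<open>O(1 / y)\<close> by another integration by parts if \<open>N \<ge> 1\<close> and tends to \<open>0\<close> by the
  Riemann--Lebesgue lemma if \<open>N = 0\<close>.
\<close>

section \<open>Fourier integrals on the real line\<close>

lemma fourier_of_real:
  "fourier f (complex_of_real u) = (LINT t|lborel. complex_of_real (f t) * cis (- (u * t)))"
  unfolding fourier_def by (simp add: cis_conv_exp mult_ac)

lemma integrable_mult_cis:
  assumes "integrable lborel f"
  shows "integrable lborel (\<lambda>t. complex_of_real (f t) * cis (- (u * t)))"
proof (rule Bochner_Integration.integrable_bound)
  show "integrable lborel f" by fact
  show "(\<lambda>t. complex_of_real (f t) * cis (- (u * t))) \<in> borel_measurable lborel"
    using assms unfolding cis_conv_exp by measurable
qed (auto simp: norm_mult)

lemma continuous_on_fourier: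
  assumes "integrable lborel f"
  shows "continuous_on A (\<lambda>u. fourier f (complex_of_real u))"
proof (rule continuous_on_subset)
  show "continuous_on UNIV (\<lambda>u. fourier f (complex_of_real u))"
    unfolding continuous_on_eq_continuous_at[OF open_UNIV] continuous_at_sequentially o_def
  proof (intro ballI allI impI)
    fix u :: real and X :: "nat \<Rightarrow> real"
    assume X: "X \<longlonglongrightarrow> u"
    show "(\<lambda>n. fourier f (complex_of_real (X n))) \<longlonglongrightarrow> fourier f (complex_of_real u)"
      unfolding fourier_of_real
    proof (rule integral_dominated_convergence[where w = "\<lambda>t. \<bar>f t\<bar>"])
      show "AE t in lborel. (\<lambda>n. complex_of_real (f t) * cis (- (X n * t)))
              \<longlonglongrightarrow> complex_of_real (f t) * cis (- (u * t))"
        using X by (intro AE_I2 tendsto_intros)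
    qed (use assms integrable_mult_cis[OF assms] in \<open>auto simp: norm_mult intro: borel_measurable_integrable\<close>)
  qed
qed simp

lemma Re_fourier_mult_cis:
  assumes "integrable lborel f"
  shows "Re (fourier f (complex_of_real u) * cis (u * y)) = (LINT t|lborel. f t * cos (u * (y - t)))"
proof -
  have "fourier f (complex_of_real u) * cis (u * y)
      = (LINT t|lborel. complex_of_real (f t) * cis (- (u * t)) * cis (u * y))"
    unfolding fourier_of_real by simp
  also have "Re \<dots> = (LINT t|lborel. Re (complex_of_real (f t) * cis (- (u * t)) * cis (u * y)))"
    using integrable_mult_cis[OF assms] by (intro integral_Re[symmetric] integrable_mult_left) auto
  also have "\<dots> = (LINT t|lborel. f t * cos (u * (y - t)))"
    by (simp add: cos_diff right_diff_distrib algebra_simps)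
  finally show ?thesis .
qed

text \<open>Fubini, with the cosine bounded by 1, so that the product of \<open>f\<close> and the
  weight restricted to \<open>{0..R}\<close> dominates. The weight is 1 for the payoff coefficient
  and \<open>exp (- (e * u))\<close> for the Abel means, which lets both go through the same
  exchange of integrals.\<close>

lemma integral_fourier_weighted:
  fixes f w :: "real \<Rightarrow> real"
  assumes f: "integrable lborel f" and w: "continuous_on {0..R} w"
  shows "integral {0..R} (\<lambda>u. w u * Re (fourier f (complex_of_real u) * cis (u * y)))
       = (LINT t|lborel. f t * integral {0..R} (\<lambda>u. w u * cos (u * (y - t))))"
proof -
  define v where "v u = indicator {0..R} u * w u" for u
  define h where "h t u = f t * v u * cos (u * (y - t))" for t u
  have v: "integrable lborel v"
    using borel_integrable_atLeastAtMost'[OF w] by (simp add: set_integrable_def v_def[abs_def])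
  have [measurable]: "f \<in> borel_measurable borel" "v \<in> borel_measurable borel"
    using f v by auto
  have prod: "integrable (lborel \<Otimes>\<^sub>M lborel) (\<lambda>(t, u). f t * v u)"
    by (rule lborel_pair.Fubini_integrable) (use f v in \<open>auto simp: abs_mult\<close>)
  have "integrable (lborel \<Otimes>\<^sub>M lborel) (case_prod h)"
  proof (rule Bochner_Integration.integrable_bound[OF prod])
    show "case_prod h \<in> borel_measurable (lborel \<Otimes>\<^sub>M lborel)"
      unfolding h_def by measurable
    show "AE x in lborel \<Otimes>\<^sub>M lborel. norm (case_prod h x) \<le> norm (case x of (t, u) \<Rightarrow> f t * v u)"
      by (auto simp: h_def abs_mult split: prod.splits intro!: AE_I2 mult_left_le)
  qed
  then have "(LINT u|lborel. LINT t|lborel. h t u) = (LINT t|lborel. LINT u|lborel. h t u)"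
    by (rule lborel_pair.Fubini_integral)
  moreover have "(LINT u|lborel. h t u) = f t * integral {0..R} (\<lambda>u. w u * cos (u * (y - t)))" for t
  proof -
    have "continuous_on {0..R} (\<lambda>u. w u * cos (u * (y - t)))"
      by (intro continuous_intros w)
    then have "(LINT u:{0..R}|lborel. w u * cos (u * (y - t)))
        = integral {0..R} (\<lambda>u. w u * cos (u * (y - t)))"
      by (intro set_borel_integral_eq_integral(2) borel_integrable_atLeastAtMost')
    then show ?thesis
      by (simp add: h_def v_def set_lebesgue_integral_def mult.assoc)
  qed
  moreover have "(LINT u|lborel. LINT t|lborel. h t u)
      = integral {0..R} (\<lambda>u. w u * Re (fourier f (complex_of_real u) * cis (u * y)))"
  proof -
    have "(LINT t|lborel. h t u) = v u * Re (fourier f (complex_of_real u) * cis (u * y))" for u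
    proof -
      have "(LINT t|lborel. h t u) = (LINT t|lborel. v u * (f t * cos (u * (y - t))))"
        by (simp add: h_def mult_ac)
      then show ?thesis
        by (simp add: Re_fourier_mult_cis[OF f] del: times_complex.sel)
    qed
    moreover have "continuous_on {0..R} (\<lambda>u. w u * Re (fourier f (complex_of_real u) * cis (u * y)))"
      by (intro continuous_intros w continuous_on_fourier f)
    then have "(LINT u:{0..R}|lborel. w u * Re (fourier f (complex_of_real u) * cis (u * y)))
        = integral {0..R} (\<lambda>u. w u * Re (fourier f (complex_of_real u) * cis (u * y)))"
      by (intro set_borel_integral_eq_integral(2) borel_integrable_atLeastAtMost')
    ultimately show ?thesis
      by (simp add: v_def set_lebesgue_integral_def mult.assoc del: times_complex.sel)
  qed
  ultimately show ?thesis by simp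
qed

lemma integral_cos_mult:
  fixes R s :: real
  assumes "R \<ge> 0"
  shows "integral {0..R} (\<lambda>u. cos (u * s)) = (if s = 0 then R else sin (R * s) / s)"
proof (cases "s = 0")
  case False
  have "((\<lambda>u. cos (u * s)) has_integral (sin (R * s) / s - sin (0 * s) / s)) {0..R}"
    by (rule fundamental_theorem_of_calculus[where f = "\<lambda>u. sin (u * s) / s"])
      (use assms False in \<open>auto intro!: derivative_eq_intros
         simp flip: has_real_derivative_iff_has_vector_derivative\<close>)
  then show ?thesis using False by (simp add: integral_unique)
qed (use assms in simp)

text \<open>The closed form separates the Poisson kernel, independent of \<open>R\<close>, from a
  boundary term carrying the factor \<open>exp (- (e * R))\<close>. Only the former survives as
  \<open>R\<close> grows.\<close>

lemma integral_exp_cos_mult: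
  fixes R e s :: real
  assumes "R \<ge> 0" "e > 0"
  shows "integral {0..R} (\<lambda>u. exp (- (e * u)) * cos (u * s))
       = e / (e\<^sup>2 + s\<^sup>2) + exp (- (e * R)) * (s * sin (R * s) - e * cos (R * s)) / (e\<^sup>2 + s\<^sup>2)"
proof -
  have nz: "e\<^sup>2 + s\<^sup>2 \<noteq> 0" using assms(2) by (simp add: sum_power2_eq_zero_iff)
  let ?A = "\<lambda>u. exp (- (e * u)) * (s * sin (u * s) - e * cos (u * s)) / (e\<^sup>2 + s\<^sup>2)"
  have "((\<lambda>u. exp (- (e * u)) * cos (u * s)) has_integral (?A R - ?A 0)) {0..R}"
  proof (rule fundamental_theorem_of_calculus)
    fix u assume "u \<in> {0..R}"
    have "(?A has_real_derivative
        (exp (- (e * u)) * (- e) * (s * sin (u * s) - e * cos (u * s))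
          + exp (- (e * u)) * (s * (cos (u * s) * s) + e * (sin (u * s) * s))) / (e\<^sup>2 + s\<^sup>2))
        (at u within {0..R})"
      by (intro DERIV_cdivide) (auto intro!: derivative_eq_intros simp: algebra_simps)
    also have "(exp (- (e * u)) * (- e) * (s * sin (u * s) - e * cos (u * s))
          + exp (- (e * u)) * (s * (cos (u * s) * s) + e * (sin (u * s) * s))) / (e\<^sup>2 + s\<^sup>2)
        = exp (- (e * u)) * cos (u * s) * (e\<^sup>2 + s\<^sup>2) / (e\<^sup>2 + s\<^sup>2)"
      by (simp add: algebra_simps power2_eq_square)
    also have "\<dots> = exp (- (e * u)) * cos (u * s)" using nz by simp
    finally show "(?A has_vector_derivative exp (- (e * u)) * cos (u * s)) (at u within {0..R})"
      by (simp add: has_real_derivative_iff_has_vector_derivative)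
  qed (use assms in simp)
  then show ?thesis by (simp add: integral_unique)
qed

text \<open>A shifted sinc is itself a cosine integral over the frequency band, centred at the grid
  point. Inserting this and exchanging integrals turns the coefficient into a truncated inversion
  integral.\<close>

lemma payoff_coeff_eq_integral:
  assumes f: "integrable lborel (damped \<alpha> P)" and r: "r = 2 powr of_int m * pi"
  shows "payoff_coeff \<alpha> P m k = 2 powr (- of_int m / 2) / pi *
    integral {0..r} (\<lambda>u. Re (damped_hat \<alpha> P u * cis (u * grid m k)))"
proof -
  have r0: "r > 0" by (simp add: r)
  have sh: "shannon m k t
      = 2 powr (- of_int m / 2) / pi * integral {0..r} (\<lambda>u. cos (u * (grid m k - t)))" for t
  proof -
    \<comment> \<open>The factor \<open>2 powr of_int m\<close> split off here is
      \<open>r / pi\<close>: it matches the cosine integral at 0, whose value is \<open>r\<close>,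
      and elsewhere cancels against the denominator of the sinc.\<close>
    have c: "(2::real) powr (of_int m / 2) = 2 powr (- of_int m / 2) * 2 powr of_int m"
      by (simp flip: powr_add)
    have x: "2 powr of_int m * t - of_int k = - (2 powr of_int m * (grid m k - t))"
      by (simp add: grid_def right_diff_distrib)
    show ?thesis
      unfolding shannon_def nsinc_def x integral_cos_mult[OF less_imp_le[OF r0]] c
      by (simp add: r mult_ac)
  qed
  have "integral {0..r} (\<lambda>u. 1 * Re (damped_hat \<alpha> P u * cis (u * grid m k)))
     = (LINT t|lborel. damped \<alpha> P t * integral {0..r} (\<lambda>u. 1 * cos (u * (grid m k - t))))"
    unfolding damped_hat_def by (intro integral_fourier_weighted f continuous_intros)
  then show ?thesis
    unfolding payoff_coeff_def sh
    by (simp add: mult.left_commute[of _ "_ / _"] del: times_complex.sel times_divide_eq_left)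
qed

section \<open>Inversion at a continuity point\<close>

text \<open>Integration by parts against \<open>H\<close>, the deviation of the partial integral
  from \<open>L\<close>, writes \<open>A e - L\<close> as the limit of \<open>e\<close> times the
  integral of \<open>exp (- (e * u)) * H u\<close>. The weight \<open>e * exp (- (e * u))\<close>
  has mass at most 1, so the late, small values of \<open>H\<close> stay small, while the early
  values on \<open>{0..M}\<close> contribute at most \<open>e * (B * M)\<close>, which vanishes with
  \<open>e\<close>.\<close>

lemma abel_limit_integral:
  fixes g :: "real \<Rightarrow> real"
  assumes g: "continuous_on {0..} g"
    and J: "((\<lambda>R. integral {0..R} g) \<longlongrightarrow> L) at_top"
    and A: "\<And>e. e > 0 \<Longrightarrow> ((\<lambda>R. integral {0..R} (\<lambda>u. exp (- (e * u)) * g u)) \<longlongrightarrow> A e) at_top"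
  shows "(A \<longlongrightarrow> L) (at_right 0)"
proof -
  define H where "H R = integral {0..R} g - L" for R
  \<comment> \<open>This boundary value at 0 is the source of the summand \<open>L\<close> in
    \<open>parts\<close>.\<close>
  have H0: "H 0 = - L" by (simp add: H_def)
  have gR: "continuous_on {0..R} g" for R
    using g by (rule continuous_on_subset) auto
  have H': "(H has_vector_derivative g u) (at u within {0..R})" if "u \<in> {0..R}" for u R
    unfolding H_def using integral_has_vector_derivative[OF gR that]
    by (auto intro!: derivative_eq_intros)
  have Hc: "continuous_on {0..R} H" for R
    using H' by (intro continuous_on_vector_derivative)
  have parts: "integral {0..R} (\<lambda>u. exp (- (e * u)) * g u)
      = exp (- (e * R)) * H R + L + e * integral {0..R} (\<lambda>u. exp (- (e * u)) * H u)"
    if "R \<ge> 0" for R e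
  proof -
    have "((\<lambda>u. exp (- (e * u)) * g u + (- e * exp (- (e * u))) * H u) has_integral
        (exp (- (e * R)) * H R - exp (- (e * 0)) * H 0)) {0..R}"
    proof (rule fundamental_theorem_of_calculus[where f = "\<lambda>u. exp (- (e * u)) * H u"])
      fix u assume u: "u \<in> {0..R}"
      have "(H has_real_derivative g u) (at u within {0..R})"
        using H'[OF u] by (simp add: has_real_derivative_iff_has_vector_derivative)
      then show "((\<lambda>u. exp (- (e * u)) * H u) has_vector_derivative
          exp (- (e * u)) * g u + (- e * exp (- (e * u))) * H u) (at u within {0..R})"
        unfolding has_real_derivative_iff_has_vector_derivative[symmetric]
        by (auto intro!: derivative_eq_intros simp: algebra_simps)
    qed (rule that)
    then have "integral {0..R} (\<lambda>u. exp (- (e * u)) * g u + (- e * exp (- (e * u))) * H u)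
        = exp (- (e * R)) * H R + L"
      by (simp add: integral_unique H0)
    moreover have "integral {0..R} (\<lambda>u. exp (- (e * u)) * g u + (- e * exp (- (e * u))) * H u)
        = integral {0..R} (\<lambda>u. exp (- (e * u)) * g u)
          + integral {0..R} (\<lambda>u. - e * (exp (- (e * u)) * H u))"
      unfolding mult.assoc
      by (intro Henstock_Kurzweil_Integration.integral_add integrable_continuous_real continuous_intros gR Hc)
    ultimately show ?thesis by simp
  qed
  show ?thesis
  proof (rule tendstoI)
    fix d :: real assume d: "d > 0"
    \<comment> \<open>The budget is one \<open>n\<close> for the boundary term at \<open>R\<close>,
      one for the tail beyond \<open>M\<close>, and one for the head once \<open>e\<close> is small:
      \<open>3 * n < d\<close>.\<close>
    define n where "n = d / 4"
    have n: "n > 0" using d by (simp add: n_def)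
    have "eventually (\<lambda>R. \<bar>H R\<bar> < n) at_top"
      using tendstoD[OF J n] by (simp add: H_def dist_real_def)
    then obtain M0 where M0: "\<And>R. R \<ge> M0 \<Longrightarrow> \<bar>H R\<bar> < n"
      by (auto simp: eventually_at_top_linorder)
    define M where "M = max M0 0"
    have M: "M \<ge> 0" and HM: "\<And>R. R \<ge> M \<Longrightarrow> \<bar>H R\<bar> < n"
      using M0 by (auto simp: M_def)
    have "compact (H ` {0..M})"
      by (intro compact_continuous_image Hc compact_Icc)
    then have "bounded (H ` {0..M})" by (rule compact_imp_bounded)
    then obtain B where B: "\<And>u. u \<in> {0..M} \<Longrightarrow> \<bar>H u\<bar> \<le> B"
      unfolding bounded_iff real_norm_def by blast
    have B0: "B \<ge> 0" using B[of 0] M by auto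
    have bound: "\<bar>A e - L\<bar> \<le> 2 * n + e * (B * M)" if e: "e > 0" for e
    proof (rule tendsto_upperbound)
      show "((\<lambda>R. \<bar>integral {0..R} (\<lambda>u. exp (- (e * u)) * g u) - L\<bar>) \<longlongrightarrow> \<bar>A e - L\<bar>) at_top"
        by (intro tendsto_intros A e)
      show "eventually (\<lambda>R. \<bar>integral {0..R} (\<lambda>u. exp (- (e * u)) * g u) - L\<bar>
          \<le> 2 * n + e * (B * M)) at_top"
        using eventually_ge_at_top[of M]
      proof eventually_elim
        case (elim R)
        have eH: "continuous_on {a..b} (\<lambda>u. exp (- (e * u)) * H u)" if "a \<ge> 0" for a b
          by (intro continuous_intros continuous_on_subset[OF Hc[of b]]) (use that in auto)
        have split: "integral {0..R} (\<lambda>u. exp (- (e * u)) * H u)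
            = integral {0..M} (\<lambda>u. exp (- (e * u)) * H u) + integral {M..R} (\<lambda>u. exp (- (e * u)) * H u)"
          using M elim
          by (intro Henstock_Kurzweil_Integration.integral_combine[symmetric]
              integrable_continuous_real eH) auto
        have "norm (integral {0..M} (\<lambda>u. exp (- (e * u)) * H u)) \<le> B * (M - 0)"
        proof (rule integral_bound)
          fix u assume u: "u \<in> {0..M}"
          have "exp (- (e * u)) * \<bar>H u\<bar> \<le> 1 * B"
            using u e B[OF u] by (intro mult_mono) auto
          then show "norm (exp (- (e * u)) * H u) \<le> B" by (simp add: abs_mult)
        qed (use M eH in auto)
        then have 1: "\<bar>integral {0..M} (\<lambda>u. exp (- (e * u)) * H u)\<bar> \<le> B * M" by simp
        \<comment> \<open>The majorant of the tail is integrated exactly: its integral is at most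
          \<open>n / e\<close>, and the prefactor \<open>e\<close> in \<open>parts\<close> reduces
          this to \<open>n\<close>, uniformly in \<open>R\<close>.\<close>
        have I: "((\<lambda>u. n * exp (- (e * u))) has_integral
            (- (n / e) * exp (- (e * R)) - (- (n / e) * exp (- (e * M))))) {M..R}"
          by (rule fundamental_theorem_of_calculus[where f = "\<lambda>u. - (n / e) * exp (- (e * u))"])
            (use elim e in \<open>auto intro!: derivative_eq_intros
               simp flip: has_real_derivative_iff_has_vector_derivative\<close>)
        have "norm (integral {M..R} (\<lambda>u. exp (- (e * u)) * H u))
            \<le> integral {M..R} (\<lambda>u. n * exp (- (e * u)))"
        proof (rule integral_norm_bound_integral)
          fix u assume "u \<in> {M..R}"
          then show "norm (exp (- (e * u)) * H u) \<le> n * exp (- (e * u))"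
            using HM[of u] by (simp add: abs_mult mult.commute)
        qed (use M in \<open>auto intro!: integrable_continuous_real eH continuous_intros\<close>)
        also have "\<dots> \<le> n / e"
        proof -
          have "n / e * exp (- (e * M)) \<le> n / e * 1"
            using n e M by (intro mult_left_mono) auto
          moreover have "0 \<le> n / e * exp (- (e * R))" using n e by auto
          ultimately show ?thesis unfolding integral_unique[OF I] by linarith
        qed
        finally have 2: "\<bar>integral {M..R} (\<lambda>u. exp (- (e * u)) * H u)\<bar> \<le> n / e" by simp
        have "\<bar>exp (- (e * R)) * H R\<bar> \<le> 1 * n"
          unfolding abs_mult using HM[OF elim] e M elim by (intro mult_mono) auto
        moreover have "\<bar>e * integral {0..R} (\<lambda>u. exp (- (e * u)) * H u)\<bar> \<le> e * (B * M + n / e)"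
          unfolding abs_mult split using 1 2 e by (intro mult_mono) auto
        moreover have "e * (B * M + n / e) = e * (B * M) + n" using e by (simp add: algebra_simps)
        ultimately show ?case
          using parts[of R e] M elim by linarith
      qed
    qed simp
    have "eventually (\<lambda>e. e * (B * M) < n) (at_right 0)"
    proof (rule order_tendstoD(2)[OF _ n])
      have "((\<lambda>e. e * (B * M)) \<longlongrightarrow> 0 * (B * M)) (at_right 0)" by (intro tendsto_intros)
      then show "((\<lambda>e. e * (B * M)) \<longlongrightarrow> 0) (at_right 0)" by simp
    qed
    then show "eventually (\<lambda>e. dist (A e) L < d) (at_right 0)"
      using eventually_at_right_less[of 0]
    proof eventually_elim
      case (elim e)
      then show ?case using bound[of e] d by (simp add: dist_real_def n_def)
    qed
  qed
qed

lemma integrable_mult_bounded: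
  fixes f g :: "real \<Rightarrow> real"
  assumes f: "integrable lborel f" and g: "g \<in> borel_measurable lborel" and C: "\<And>t. \<bar>g t\<bar> \<le> C"
  shows "integrable lborel (\<lambda>t. f t * g t)"
proof (rule Bochner_Integration.integrable_bound)
  show "integrable lborel (\<lambda>t. f t * C)" using f by (intro integrable_mult_left) auto
  show "(\<lambda>t. f t * g t) \<in> borel_measurable lborel" using f g by measurable
  show "AE t in lborel. norm (f t * g t) \<le> norm (f t * C)"
    unfolding real_norm_def abs_mult by (intro AE_I2 mult_left_mono order_trans[OF C abs_ge_self]) simp
qed

lemma integrable_mult_poisson:
  fixes f :: "real \<Rightarrow> real"
  assumes f: "integrable lborel f" and e: "e > 0"
  shows "integrable lborel (\<lambda>t. f t * (e / (e\<^sup>2 + (y - t)\<^sup>2)))"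
proof (rule integrable_mult_bounded[OF f, where C = "1 / e"])
  fix t
  have "e\<^sup>2 + (y - t)\<^sup>2 > 0" using e by (simp add: add_pos_nonneg)
  then show "\<bar>e / (e\<^sup>2 + (y - t)\<^sup>2)\<bar> \<le> 1 / e"
    using e by (simp add: divide_simps power2_eq_square)
qed measurable

text \<open>Inside the window of radius \<open>d\<close> around \<open>y\<close>, \<open>f\<close>
  is replaced by \<open>f y\<close> at a cost of \<open>n\<close> times the mass of the kernel,
  which is \<open>2 * arctan (d / e)\<close> and hence below \<open>pi\<close>. Outside, the kernel
  is at most \<open>e / d\<^sup>2\<close>. Comparing with the mass of the window instead of the
  total mass \<open>pi\<close> means that the kernel is integrated over a compact interval
  only.\<close>

lemma poisson_integral_bound:
  assumes f: "integrable lborel f" and e: "e > 0" and d: "d > 0" and n: "n \<ge> 0"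
    and close: "\<And>t. \<bar>t - y\<bar> \<le> d \<Longrightarrow> \<bar>f t - f y\<bar> \<le> n"
  shows "\<bar>(LINT t|lborel. f t * (e / (e\<^sup>2 + (y - t)\<^sup>2))) - f y * (2 * arctan (d / e))\<bar>
       \<le> n * pi + e / d\<^sup>2 * (LINT t|lborel. \<bar>f t\<bar>)"
proof -
  define p where "p t = e / (e\<^sup>2 + (y - t)\<^sup>2)" for t
  define q where "q t = indicator {y - d..y + d} t * p t" for t
  have pos: "e\<^sup>2 + (y - t)\<^sup>2 > 0" for t using e by (simp add: add_pos_nonneg)
  have p0: "p t \<ge> 0" for t using e pos[of t] by (simp add: p_def)
  have pc: "continuous_on S p" for S
    unfolding p_def using pos by (intro continuous_intros) (auto simp: less_le)
  have q: "integrable lborel q"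
    using borel_integrable_atLeastAtMost'[OF pc[of "{y - d..y + d}"]]
    by (simp add: set_integrable_def q_def[abs_def])
  have "((\<lambda>t. p t) has_integral (arctan ((y + d - y) / e) - arctan ((y - d - y) / e))) {y - d..y + d}"
  proof (rule fundamental_theorem_of_calculus[where f = "\<lambda>t. arctan ((t - y) / e)"])
    fix t
    have "((\<lambda>t. arctan ((t - y) / e)) has_real_derivative (1 / e) * inverse (1 + ((t - y) / e)\<^sup>2))
        (at t within {y - d..y + d})"
      using e by (auto intro!: derivative_eq_intros)
    also have "(1 / e) * inverse (1 + ((t - y) / e)\<^sup>2) = p t"
      using e pos[of t] by (simp add: p_def field_simps power2_eq_square)
    finally show "((\<lambda>t. arctan ((t - y) / e)) has_vector_derivative p t) (at t within {y - d..y + d})"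
      by (simp add: has_real_derivative_iff_has_vector_derivative)
  qed (use d in simp)
  then have "integral {y - d..y + d} p = 2 * arctan (d / e)"
    by (simp add: integral_unique arctan_minus)
  then have qi: "(LINT t|lborel. q t) = 2 * arctan (d / e)"
    using set_borel_integral_eq_integral(2)[OF borel_integrable_atLeastAtMost'[OF pc[of "{y - d..y + d}"]]]
    by (simp add: set_lebesgue_integral_def q_def)
  have fp: "integrable lborel (\<lambda>t. f t * p t)"
    unfolding p_def by (rule integrable_mult_poisson[OF f e])
  have "norm (LINT t|lborel. f t * p t - f y * q t)
      \<le> (LINT t|lborel. n * q t + e / d\<^sup>2 * \<bar>f t\<bar>)"
  proof (rule Bochner_Integration.integral_norm_bound_integral)
    show "integrable lborel (\<lambda>t. f t * p t - f y * q t)" using fp q by simp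
    show "integrable lborel (\<lambda>t. n * q t + e / d\<^sup>2 * \<bar>f t\<bar>)" using f q by simp
    fix t
    show "norm (f t * p t - f y * q t) \<le> n * q t + e / d\<^sup>2 * \<bar>f t\<bar>"
    proof (cases "\<bar>t - y\<bar> \<le> d")
      case True
      then have qt: "q t = p t" by (auto simp: q_def indicator_def)
      have "\<bar>f t * p t - f y * p t\<bar> = \<bar>f t - f y\<bar> * p t"
        using p0[of t] by (simp add: abs_mult flip: left_diff_distrib)
      also have "\<dots> \<le> n * p t" using close[OF True] p0 by (intro mult_right_mono)
      finally show ?thesis using e by (simp add: qt add_increasing2)
    next
      case False
      then have qt: "q t = 0" by (auto simp: q_def indicator_def)
      have "d\<^sup>2 \<le> (y - t)\<^sup>2" using False d abs_le_square_iff[of d "y - t"] by linarith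
      then have "p t \<le> e / d\<^sup>2"
        unfolding p_def using e d pos[of t] by (intro divide_left_mono) (auto intro: add_increasing)
      then have "\<bar>f t\<bar> * p t \<le> \<bar>f t\<bar> * (e / d\<^sup>2)" by (intro mult_left_mono) auto
      then show ?thesis using p0[of t] by (simp add: qt abs_mult mult.commute)
    qed
  qed
  also have "\<dots> = n * (2 * arctan (d / e)) + e / d\<^sup>2 * (LINT t|lborel. \<bar>f t\<bar>)"
    using f q by (simp add: qi)
  also have "\<dots> \<le> n * pi + e / d\<^sup>2 * (LINT t|lborel. \<bar>f t\<bar>)"
    using n arctan_ubound[of "d / e"] by (intro add_right_mono mult_left_mono) auto
  also have "(LINT t|lborel. f t * p t - f y * q t)
      = (LINT t|lborel. f t * p t) - f y * (2 * arctan (d / e))"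
    using fp q by (simp add: qi)
  finally show ?thesis by (simp add: p_def)
qed

text \<open>The Abel means of the inversion integral are computed in two ways. Convergence makes
  them tend to \<open>L\<close>; by Fubini they equal the Poisson integrals \<open>K e\<close>,
  which concentrate at \<open>y\<close> and so approach \<open>pi * f y\<close>.\<close>

lemma fourier_inversion_of_convergent:
  assumes f: "integrable lborel f" and y: "isCont f y"
    and L: "((\<lambda>R. integral {0..R} (\<lambda>u. Re (fourier f (complex_of_real u) * cis (u * y)))) \<longlongrightarrow> L) at_top"
  shows "L = pi * f y"
proof -
  define K where "K e = (LINT t|lborel. f t * (e / (e\<^sup>2 + (y - t)\<^sup>2)))" for e
  define F where "F = (LINT t|lborel. \<bar>f t\<bar>)"
  have [measurable]: "f \<in> borel_measurable borel" using f by auto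
  have "(K \<longlongrightarrow> L) (at_right 0)"
  proof (rule abel_limit_integral[OF _ L])
    show "continuous_on {0..} (\<lambda>u. Re (fourier f (complex_of_real u) * cis (u * y)))"
      by (intro continuous_intros continuous_on_fourier f)
    fix e :: real assume e: "e > 0"
    let ?I = "\<lambda>R. integral {0..R} (\<lambda>u. exp (- (e * u)) * Re (fourier f (complex_of_real u) * cis (u * y)))"
    \<comment> \<open>The boundary term of \<open>integral_exp_cos_mult\<close> stripped of its
      exponential. A bound uniform in \<open>R\<close> and \<open>t\<close> suffices, because the
      exponential then forces convergence; 2 / e comes from the inequality between arithmetic and
      geometric means for \<open>\<bar>s\<bar>\<close> and \<open>e\<close>.\<close>
    define q where "q R t = ((y - t) * sin (R * (y - t)) - e * cos (R * (y - t))) / (e\<^sup>2 + (y - t)\<^sup>2)" for R t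
    have q: "\<bar>q R t\<bar> \<le> 2 / e" for R t
    proof -
      define s where "s = y - t"
      have pos: "e\<^sup>2 + s\<^sup>2 > 0" using e by (simp add: add_pos_nonneg)
      have "\<bar>s * sin (R * s) - e * cos (R * s)\<bar> \<le> \<bar>s\<bar> * 1 + e * 1"
        using e by (intro order_trans[OF abs_triangle_ineq4] add_mono)
          (auto simp: abs_mult intro!: mult_left_le)
      moreover have "(\<bar>s\<bar> + e) * e \<le> 2 * (e\<^sup>2 + s\<^sup>2)"
      proof -
        have "0 \<le> (\<bar>s\<bar> - e)\<^sup>2" by simp
        then have "2 * (\<bar>s\<bar> * e) \<le> e\<^sup>2 + s\<^sup>2" by (simp add: power2_diff)
        moreover have "0 \<le> \<bar>s\<bar> * e" using e by simp
        ultimately have "\<bar>s\<bar> * e \<le> e\<^sup>2 + s\<^sup>2" by linarith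
        then show ?thesis using zero_le_power2[of s]
          unfolding distrib_right power2_eq_square[symmetric] distrib_left by linarith
      qed
      moreover from calculation(1) have "\<bar>s * sin (R * s) - e * cos (R * s)\<bar> * e \<le> (\<bar>s\<bar> + e) * e"
        using e by (intro mult_right_mono) auto
      ultimately have "\<bar>s * sin (R * s) - e * cos (R * s)\<bar> * e \<le> 2 * (e\<^sup>2 + s\<^sup>2)"
        by linarith
      then show ?thesis using pos e unfolding q_def s_def[symmetric]
        by (simp add: abs_divide field_simps)
    qed
    have bound: "norm (?I R - K e) \<le> exp (- (e * R)) * (2 / e * F)" if R: "R \<ge> 0" for R
    proof -
      have qf: "integrable lborel (\<lambda>t. f t * q R t)"
        by (rule integrable_mult_bounded[OF f _ q]) (simp add: q_def)
      have "?I R = (LINT t|lborel. f t * integral {0..R} (\<lambda>u. exp (- (e * u)) * cos (u * (y - t))))"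
        by (intro integral_fourier_weighted f continuous_intros)
      also have "\<dots> = (LINT t|lborel. f t * (e / (e\<^sup>2 + (y - t)\<^sup>2)) + exp (- (e * R)) * (f t * q R t))"
        unfolding integral_exp_cos_mult[OF R e] q_def by (simp add: algebra_simps)
      also have "\<dots> = K e + exp (- (e * R)) * (LINT t|lborel. f t * q R t)"
        unfolding K_def using qf integrable_mult_poisson[OF f e] by simp
      finally have "norm (?I R - K e) = exp (- (e * R)) * \<bar>LINT t|lborel. f t * q R t\<bar>"
        by (simp add: abs_mult)
      also have "\<bar>LINT t|lborel. f t * q R t\<bar> \<le> (LINT t|lborel. 2 / e * \<bar>f t\<bar>)"
        unfolding real_norm_def[symmetric]
      proof (rule Bochner_Integration.integral_norm_bound_integral[OF qf])
        fix t show "norm (f t * q R t) \<le> 2 / e * norm (f t)"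
          using q[of R t] unfolding norm_mult by (subst mult.commute) (intro mult_right_mono, auto)
      qed (use f in auto)
      finally show ?thesis by (simp add: F_def mult_left_mono)
    qed
    show "(?I \<longlongrightarrow> K e) at_top"
    proof (rule Lim_null[THEN iffD2], rule Lim_null_comparison)
      show "eventually (\<lambda>R. norm (?I R - K e) \<le> exp (- (e * R)) * (2 / e * F)) at_top"
        using eventually_ge_at_top[of 0] by eventually_elim (rule bound)
      have "((\<lambda>R. exp (- (e * R))) \<longlongrightarrow> 0) at_top"
        using e by real_asymp
      then show "((\<lambda>R. exp (- (e * R)) * (2 / e * F)) \<longlongrightarrow> 0) at_top"
        by (rule tendsto_mult_left_zero)
    qed
  qed
  have le: "\<bar>L - f y * pi\<bar> \<le> n * pi" if n: "n > 0" for n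
  proof -
    obtain d0 where d0: "d0 > 0" "\<And>t. dist t y < d0 \<Longrightarrow> dist (f t) (f y) < n"
      using y n unfolding continuous_at_eps_delta by (auto simp: dist_commute)
    define d where "d = d0 / 2"
    have d: "d > 0" and close: "\<And>t. \<bar>t - y\<bar> \<le> d \<Longrightarrow> \<bar>f t - f y\<bar> \<le> n"
      using d0 by (auto simp: d_def dist_real_def less_imp_le)
    show ?thesis
    proof (rule tendsto_le)
      \<comment> \<open>The Poisson mass of every fixed window tends to the total mass
        \<open>pi\<close>. The limit \<open>e\<close> to 0 is taken with \<open>n\<close> and
        \<open>d\<close> fixed; \<open>n\<close> is made small only afterwards.\<close>
      have "((\<lambda>e. arctan (d / e)) \<longlongrightarrow> pi / 2) (at_right 0)"
        using d by real_asymp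
      then have "((\<lambda>e. \<bar>K e - f y * (2 * arctan (d / e))\<bar>) \<longlongrightarrow> \<bar>L - f y * (2 * (pi / 2))\<bar>) (at_right 0)"
        by (intro tendsto_intros \<open>(K \<longlongrightarrow> L) (at_right 0)\<close>)
      then show "((\<lambda>e. \<bar>K e - f y * (2 * arctan (d / e))\<bar>) \<longlongrightarrow> \<bar>L - f y * pi\<bar>) (at_right 0)"
        by simp
      have "((\<lambda>e. n * pi + e / d\<^sup>2 * F) \<longlongrightarrow> n * pi + 0 / d\<^sup>2 * F) (at_right 0)"
        by (intro tendsto_intros) (use d in auto)
      then show "((\<lambda>e. n * pi + e / d\<^sup>2 * F) \<longlongrightarrow> n * pi) (at_right 0)"
        by simp
      show "eventually (\<lambda>e. \<bar>K e - f y * (2 * arctan (d / e))\<bar> \<le> n * pi + e / d\<^sup>2 * F) (at_right 0)"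
        using eventually_at_right_less[of 0]
        by eventually_elim
          (use poisson_integral_bound[OF f _ d less_imp_le[OF n] close] in \<open>simp add: K_def F_def\<close>)
    qed simp
  qed
  have "\<bar>L - f y * pi\<bar> \<le> 0 + e" if "e > 0" for e
    using le[of "e / pi"] that by simp
  then have "\<bar>L - f y * pi\<bar> \<le> 0" by (rule field_le_epsilon)
  then show ?thesis by (simp add: mult.commute)
qed

section \<open>Oscillatory integrals on a half-line\<close>

text \<open>Differentiability is asked for only in the open interval, with continuity up to the
  ends, since at the left end \<open>r\<close> of the frequency range nothing is known about
  derivatives.\<close>

lemma integral_mult_cis_by_parts:
  fixes g g' :: "real \<Rightarrow> complex"
  assumes "a \<le> b" and g: "continuous_on {a..b} g"
    and g': "\<And>u. u \<in> {a<..<b} \<Longrightarrow> (g has_vector_derivative g' u) (at u)" and y: "y \<noteq> 0"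
  shows "integral {a..b} (\<lambda>u. g u * cis (u * y)) = \<i> / of_real y *
    (g a * cis (a * y) - g b * cis (b * y) + integral {a..b} (\<lambda>u. g' u * cis (u * y)))"
proof -
  \<comment> \<open>\<open>E\<close> is an antiderivative of \<open>cis (u * y)\<close>; its
    prefactor is the source of the gain \<open>1 / y\<close>.\<close>
  define E where "E u = - \<i> / of_real y * cis (u * y)" for u
  define I where "I = integral {a..b} (\<lambda>u. g u * cis (u * y))"
  have "((\<lambda>u. g' u * E u) has_integral (g b * E b - g a * E a - I)) {a..b}"
  proof (rule integration_by_parts_interior[where g' = "\<lambda>u. cis (u * y)", OF bounded_bilinear_mult])
    fix u
    show "(E has_vector_derivative cis (u * y)) (at u)"
      unfolding E_def has_vector_derivative_def
      by (rule derivative_eq_intros refl)+ (use y in \<open>auto simp: fun_eq_iff scaleR_conv_of_real mult.left_commute[of "complex_of_real _" \<i>]\<close>)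
    have "(\<lambda>u. g u * cis (u * y)) integrable_on {a..b}"
      by (intro integrable_continuous_real continuous_intros g)
    then show "((\<lambda>u. g u * cis (u * y)) has_integral (g b * E b - g a * E a - (g b * E b - g a * E a - I))) {a..b}"
      by (simp add: I_def integrable_integral)
  qed (use assms in \<open>auto simp: E_def intro!: continuous_intros\<close>)
  then have "integral {a..b} (\<lambda>u. g' u * E u) = g b * E b - g a * E a - I"
    by (rule integral_unique)
  also have "(\<lambda>u. g' u * E u) = (\<lambda>u. - \<i> / of_real y * (g' u * cis (u * y)))"
    by (simp add: E_def fun_eq_iff)
  finally show ?thesis
    unfolding Henstock_Kurzweil_Integration.integral_mult_right E_def I_def[symmetric]
    by (simp add: algebra_simps)
qed

text \<open>To the right of \<open>r\<close>, \<open>g u\<close> is \<open>g b\<close> minus the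
  integral of \<open>g'\<close> from \<open>u\<close> to \<open>b\<close>, and an indefinite
  integral is continuous up to the endpoint even if \<open>g'\<close> is unbounded there. This gives
  the derivatives of the transform boundary values at \<open>r\<close>, although they are controlled
  only beyond \<open>r\<close>.\<close>

lemma tendsto_at_right_of_integrable_deriv:
  fixes g g' :: "real \<Rightarrow> 'a::banach"
  assumes g': "\<And>u. u > r \<Longrightarrow> (g has_vector_derivative g' u) (at u)"
    and b: "r < b" and int: "g' integrable_on {r..b}"
  obtains l where "(g \<longlongrightarrow> l) (at_right r)"
proof -
  define h where "h u = g b - integral {u..b} g'" for u
  have "continuous_on {r..b} h"
    unfolding h_def by (intro continuous_intros indefinite_integral_continuous_1' int)
  then have "(h \<longlongrightarrow> h r) (at_right r)"
    using b by (auto simp: continuous_on_def at_within_Icc_at_right dest!: bspec[of _ _ r])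
  moreover have "eventually (\<lambda>u. h u = g u) (at_right r)"
    unfolding eventually_at_right_field
  proof (intro exI[of _ b] conjI allI impI b)
    fix u assume u: "r < u" "u < b"
    have "(g' has_integral (g b - g u)) {u..b}"
      using u by (intro fundamental_theorem_of_calculus has_vector_derivative_at_within[OF g']) auto
    then show "h u = g u" by (simp add: h_def integral_unique)
  qed
  ultimately show thesis using that Lim_transform_eventually by blast
qed

lemma continuous_on_extend_at_right:
  fixes g :: "real \<Rightarrow> 'a::real_normed_vector"
  assumes g: "continuous_on {r<..} g" and l: "(g \<longlongrightarrow> l) (at_right r)"
  shows "continuous_on {r..b} (g(r := l))"
proof (cases "r < b")
  case True
  show ?thesis
    unfolding continuous_on_def
  proof
    fix u assume u: "u \<in> {r..b}"
    show "(g(r := l) \<longlongrightarrow> (g(r := l)) u) (at u within {r..b})"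
    proof (cases "u = r")
      case True
      have "eventually (\<lambda>u. g u = (g(r := l)) u) (at_right r)"
        using eventually_at_right_less[of r] by eventually_elim simp
      with l have "(g(r := l) \<longlongrightarrow> l) (at_right r)" by (rule Lim_transform_eventually)
      then show ?thesis using True \<open>r < b\<close> by (simp add: at_within_Icc_at_right)
    next
      case False
      then have "r < u" using u by auto
      then have "eventually (\<lambda>v. v \<in> {r<..}) (nhds u)" by (intro eventually_nhds_in_open) auto
      then have "eventually (\<lambda>v. g v = (g(r := l)) v) (nhds u)" by eventually_elim auto
      moreover have "isCont g u"
        using g \<open>r < u\<close> by (simp add: continuous_on_eq_continuous_at)
      ultimately have "isCont (g(r := l)) u" using isCont_cong by blast
      then show ?thesis
        using continuous_at_imp_continuous_at_within continuous_within by blast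
    qed
  qed
qed (auto intro: continuous_on_subset[of "{r}"])

text \<open>The boundary term uses the one-sided limit \<open>l\<close>, not \<open>g r\<close>,
  which is unconstrained. Overwriting \<open>g\<close> at \<open>r\<close> by \<open>l\<close> makes
  it continuous on the closed interval and changes no integral.\<close>

lemma tendsto_integral_mult_cis_by_parts:
  fixes g g' :: "real \<Rightarrow> complex"
  assumes g': "\<And>u. u > r \<Longrightarrow> (g has_vector_derivative g' u) (at u)"
    and l: "(g \<longlongrightarrow> l) (at_right r)" and lim: "(g \<longlongrightarrow> 0) at_top" and y: "y \<noteq> 0"
    and T: "((\<lambda>R. integral {r..R} (\<lambda>u. g' u * cis (u * y))) \<longlongrightarrow> T) at_top"
  shows "((\<lambda>R. integral {r..R} (\<lambda>u. g u * cis (u * y))) \<longlongrightarrow>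
           \<i> / of_real y * (l * cis (r * y) + T)) at_top"
proof -
  have gc: "continuous_on {r<..} g"
    by (intro continuous_at_imp_continuous_on ballI has_vector_derivative_continuous[OF g']) auto
  have "((\<lambda>R. g R * cis (R * y)) \<longlongrightarrow> 0) at_top"
    by (rule Lim_null_comparison[OF always_eventually tendsto_norm_zero[OF lim]]) (simp add: norm_mult)
  then have 1: "((\<lambda>R. \<i> / of_real y * (l * cis (r * y) - g R * cis (R * y)
      + integral {r..R} (\<lambda>u. g' u * cis (u * y)))) \<longlongrightarrow> \<i> / of_real y * (l * cis (r * y) - 0 + T)) at_top"
    by (intro tendsto_intros T)
  have 2: "eventually (\<lambda>R. \<i> / of_real y * (l * cis (r * y) - g R * cis (R * y)
      + integral {r..R} (\<lambda>u. g' u * cis (u * y))) = integral {r..R} (\<lambda>u. g u * cis (u * y))) at_top"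
    using eventually_gt_at_top[of r]
  proof eventually_elim
    case (elim R)
    have "integral {r..R} (\<lambda>u. g u * cis (u * y)) = integral {r..R} (\<lambda>u. (g(r := l)) u * cis (u * y))"
      by (rule integral_spike[of "{r}"]) auto
    also have "\<dots> = \<i> / of_real y * ((g(r := l)) r * cis (r * y) - (g(r := l)) R * cis (R * y)
      + integral {r..R} (\<lambda>u. g' u * cis (u * y)))"
    proof (rule integral_mult_cis_by_parts)
      fix u assume "u \<in> {r<..<R}"
      then show "(g(r := l) has_vector_derivative g' u) (at u)"
        by (auto intro: has_vector_derivative_transform_within_open[OF g', where S = "{r<..}"])
    qed (use elim y continuous_on_extend_at_right[OF gc l] in auto)
    finally show ?case using elim by simp
  qed
  have "l * cis (r * y) - 0 + T = l * cis (r * y) + T" by simp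
  with Lim_transform_eventually[OF 1 2] show ?thesis by (simp only:)
qed

lemma set_integrable_mult_cis:
  fixes g :: "real \<Rightarrow> complex"
  assumes "set_integrable lborel S g"
  shows "set_integrable lborel S (\<lambda>u. g u * cis (u * y))"
proof -
  have "integrable lborel (\<lambda>u. (indicator S u *\<^sub>R g u) * cis (u * y))"
  proof (rule Bochner_Integration.integrable_bound)
    show "integrable lborel (\<lambda>u. indicator S u *\<^sub>R g u)"
      using assms by (simp add: set_integrable_def)
    then show "(\<lambda>u. (indicator S u *\<^sub>R g u) * cis (u * y)) \<in> borel_measurable lborel"
      unfolding cis_conv_exp by measurable
  qed (auto simp: norm_mult)
  then show ?thesis by (simp add: set_integrable_def)
qed

text \<open>Integration by parts works with gauge integrals over closed intervals, domination with
  Lebesgue integrals over the open half-line. The two differ only in the null set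
  \<open>{r}\<close>.\<close>

lemma integrable_on_Icc_of_set_integrable:
  fixes g :: "real \<Rightarrow> complex"
  assumes "set_integrable lborel {r<..} g"
  shows "g integrable_on {r..b}" "integral {r..b} g = (LINT u:{r<..b}|lborel. g u)"
proof -
  have S: "set_integrable lborel {r<..b} g"
    by (rule set_integrable_subset[OF assms]) auto
  have N: "negligible {x \<in> {r..b} - {r<..b}. g x \<noteq> 0}" "negligible {x \<in> {r<..b} - {r..b}. g x \<noteq> 0}"
    by (auto intro: negligible_subset[of "{r}"])
  show "g integrable_on {r..b}"
    using integrable_spike_set[OF set_borel_integral_eq_integral(1)[OF S]] N by blast
  show "integral {r..b} g = (LINT u:{r<..b}|lborel. g u)"
    using set_borel_integral_eq_integral(2)[OF S] integral_spike_set[OF N] by simp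
qed

lemma tendsto_integral_mult_cis_of_set_integrable:
  fixes g :: "real \<Rightarrow> complex"
  assumes "set_integrable lborel {r<..} g"
  shows "((\<lambda>R. integral {r..R} (\<lambda>u. g u * cis (u * y))) \<longlongrightarrow> (LINT u:{r<..}|lborel. g u * cis (u * y))) at_top"
proof -
  note S = set_integrable_mult_cis[OF assms, of y]
  have "((\<lambda>R. LINT u|lborel. indicator {..R} u *\<^sub>R (indicator {r<..} u *\<^sub>R (g u * cis (u * y)))) \<longlongrightarrow>
      (LINT u|lborel. indicator {r<..} u *\<^sub>R (g u * cis (u * y)))) at_top"
    by (rule tendsto_integral_at_top) (use S in \<open>auto simp: set_integrable_def\<close>)
  moreover have "(LINT u|lborel. indicator {..R} u *\<^sub>R (indicator {r<..} u *\<^sub>R (g u * cis (u * y))))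
      = integral {r..R} (\<lambda>u. g u * cis (u * y))" for R
    unfolding integrable_on_Icc_of_set_integrable(2)[OF S] set_lebesgue_integral_def
    by (intro Bochner_Integration.integral_cong) (auto simp: indicator_def)
  ultimately show ?thesis by (simp add: set_lebesgue_integral_def)
qed

lemma norm_set_integral_mult_cis_le:
  fixes g :: "real \<Rightarrow> complex"
  shows "norm (LINT u:S|lborel. g u * cis (u * y)) \<le> (LINT u:S|lborel. norm (g u))"
proof -
  have "norm (LINT u:S|lborel. g u * cis (u * y)) \<le> (LINT u|lborel. norm (indicator S u *\<^sub>R (g u * cis (u * y))))"
    unfolding set_lebesgue_integral_def by (rule integral_norm_bound)
  then show ?thesis by (simp add: set_lebesgue_integral_def norm_mult)
qed

text \<open>One integration by parts turns a bound for the oscillatory integrals of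
  \<open>g'\<close> that is uniform in \<open>\<bar>y\<bar> \<ge> d\<close> into decay
  \<open>1 / \<bar>y\<bar>\<close> for those of \<open>g\<close>. Integrability of \<open>g\<close>
  up to \<open>r\<close> is recorded as well, because it is what the same step requires of the
  derivative when applied one order lower.\<close>

lemma oscillatory_integral_decay_step:
  fixes g g' :: "real \<Rightarrow> complex"
  assumes g': "\<And>u. u > r \<Longrightarrow> (g has_vector_derivative g' u) (at u)"
    and lim: "(g \<longlongrightarrow> 0) at_top" and int: "\<And>b. g' integrable_on {r..b}" and d: "d > 0"
    and T': "\<And>y. d \<le> \<bar>y\<bar> \<Longrightarrow> ((\<lambda>R. integral {r..R} (\<lambda>u. g' u * cis (u * y))) \<longlongrightarrow> T' y) at_top"
    and C': "\<And>y. d \<le> \<bar>y\<bar> \<Longrightarrow> norm (T' y) \<le> C'"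
  shows "g integrable_on {r..b}"
    and "\<exists>T C. 0 \<le> C \<and> (\<forall>y. d \<le> \<bar>y\<bar> \<longrightarrow>
      ((\<lambda>R. integral {r..R} (\<lambda>u. g u * cis (u * y))) \<longlongrightarrow> T y) at_top \<and> norm (T y) \<le> C / \<bar>y\<bar>)"
proof -
  obtain l where l: "(g \<longlongrightarrow> l) (at_right r)"
    using tendsto_at_right_of_integrable_deriv[OF g' _ int, of "r + 1"] by auto
  have gc: "continuous_on {r<..} g"
    by (intro continuous_at_imp_continuous_on ballI has_vector_derivative_continuous[OF g']) auto
  have "g(r := l) integrable_on {r..b}"
    by (intro integrable_continuous_real continuous_on_extend_at_right gc l)
  then show "g integrable_on {r..b}"
    by (rule integrable_spike[of _ _ "{r}"]) auto
  define T where "T y = \<i> / of_real y * (l * cis (r * y) + T' y)" for y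
  have "norm (T y) \<le> (norm l + \<bar>C'\<bar>) / \<bar>y\<bar>" if "d \<le> \<bar>y\<bar>" for y
  proof -
    have "norm (l * cis (r * y) + T' y) \<le> norm l + \<bar>C'\<bar>"
      using C'[OF that] norm_triangle_ineq[of "l * cis (r * y)" "T' y"] by (simp add: norm_mult)
    then show ?thesis by (simp add: T_def norm_mult norm_divide divide_right_mono)
  qed
  moreover have "((\<lambda>R. integral {r..R} (\<lambda>u. g u * cis (u * y))) \<longlongrightarrow> T y) at_top" if "d \<le> \<bar>y\<bar>" for y
    unfolding T_def using that d by (intro tendsto_integral_mult_cis_by_parts[OF g' l lim _ T']) auto
  moreover have "0 \<le> norm l + \<bar>C'\<bar>" by simp
  ultimately show "\<exists>T C. 0 \<le> C \<and> (\<forall>y. d \<le> \<bar>y\<bar> \<longrightarrow>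
      ((\<lambda>R. integral {r..R} (\<lambda>u. g u * cis (u * y))) \<longlongrightarrow> T y) at_top \<and> norm (T y) \<le> C / \<bar>y\<bar>)"
    by blast
qed

text \<open>Induction down from the absolutely integrable top derivative \<open>G n\<close>, with
  the hypothesis applied to the shifted family. Each step yields \<open>C / \<bar>y\<bar>\<close>,
  weakened to the constant \<open>C / d\<close>, which is all the next step asks for.\<close>

lemma oscillatory_integral_bounded:
  fixes G :: "nat \<Rightarrow> real \<Rightarrow> complex"
  assumes "\<And>j u. j < n \<Longrightarrow> u > r \<Longrightarrow> (G j has_vector_derivative G (Suc j) u) (at u)"
    and "\<And>j. j < n \<Longrightarrow> (G j \<longlongrightarrow> 0) at_top" and "set_integrable lborel {r<..} (G n)" and d: "d > 0"
  shows "(\<forall>b. G 0 integrable_on {r..b}) \<and> (\<exists>T C. \<forall>y. d \<le> \<bar>y\<bar> \<longrightarrow>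
      ((\<lambda>R. integral {r..R} (\<lambda>u. G 0 u * cis (u * y))) \<longlongrightarrow> T y) at_top \<and> norm (T y) \<le> C)"
  using assms(1-3)
proof (induction n arbitrary: G)
  case 0
  show ?case
    by (intro conjI allI impI exI[of _ "\<lambda>y. LINT u:{r<..}|lborel. G 0 u * cis (u * y)"]
        exI[of _ "LINT u:{r<..}|lborel. norm (G 0 u)"] norm_set_integral_mult_cis_le
        integrable_on_Icc_of_set_integrable(1)[OF 0(3)] tendsto_integral_mult_cis_of_set_integrable[OF 0(3)])
next
  case (Suc n)
  have "(\<forall>b. G (Suc 0) integrable_on {r..b}) \<and> (\<exists>T C. \<forall>y. d \<le> \<bar>y\<bar> \<longrightarrow>
      ((\<lambda>R. integral {r..R} (\<lambda>u. G (Suc 0) u * cis (u * y))) \<longlongrightarrow> T y) at_top \<and> norm (T y) \<le> C)"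
    by (rule Suc.IH[of "\<lambda>j. G (Suc j)"]) (use Suc.prems in auto)
  then obtain T' C' where int: "\<And>b. G (Suc 0) integrable_on {r..b}"
    and T': "\<And>y. d \<le> \<bar>y\<bar> \<Longrightarrow> ((\<lambda>R. integral {r..R} (\<lambda>u. G (Suc 0) u * cis (u * y))) \<longlongrightarrow> T' y) at_top"
    and C': "\<And>y. d \<le> \<bar>y\<bar> \<Longrightarrow> norm (T' y) \<le> C'" by blast
  note step = oscillatory_integral_decay_step[of r "G 0" "G (Suc 0)", OF _ _ int d T' C']
  obtain T C where C0: "0 \<le> C" and T: "\<And>y. d \<le> \<bar>y\<bar> \<Longrightarrow> ((\<lambda>R. integral {r..R} (\<lambda>u. G 0 u * cis (u * y))) \<longlongrightarrow> T y) at_top"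
    and C: "\<And>y. d \<le> \<bar>y\<bar> \<Longrightarrow> norm (T y) \<le> C / \<bar>y\<bar>"
    using step(2) Suc.prems by blast
  have "norm (T y) \<le> C / d" if "d \<le> \<bar>y\<bar>" for y
    using C[OF that] divide_left_mono[OF that C0] d that
    by (smt (verit) mult_pos_pos)
  moreover have "G 0 integrable_on {r..b}" for b
    using step(1) Suc.prems by blast
  ultimately show ?case using T by blast
qed

text \<open>Cutting \<open>g\<close> down to a compact interval inside the open half-line costs
  little in the mean; there \<open>g\<close> is uniformly close to a polynomial \<open>p\<close>,
  and integration by parts bounds the oscillatory integral of \<open>p\<close> by
  \<open>K / \<bar>y\<bar>\<close>.\<close>

lemma riemann_lebesgue_Ioi:
  fixes g :: "real \<Rightarrow> complex"
  assumes g: "set_integrable lborel {r<..} g" and gc: "continuous_on {r<..} g"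
  shows "((\<lambda>y. LINT u:{r<..}|lborel. g u * cis (u * y)) \<longlongrightarrow> 0) at_infinity"
proof (rule tendstoI)
  fix e :: real assume e: "e > 0"
  define h where "h u = indicator {r<..} u *\<^sub>R g u" for u
  \<comment> \<open>These compact intervals exhaust \<open>{r<..}\<close> while keeping away from
    \<open>r\<close>, where \<open>g\<close> may be unbounded.\<close>
  define S where "S n = {r + 1 / (real n + 1)..r + 1 + real n}" for n
  have h: "integrable lborel h" using g by (simp add: set_integrable_def h_def[abs_def])
  have hm: "h \<in> borel_measurable lborel" using h by auto
  have "(\<lambda>n. LINT u|lborel. norm (h u - indicator (S n) u *\<^sub>R h u)) \<longlonglongrightarrow> (LINT u|(lborel :: real measure). (0::real))"
  proof (rule integral_dominated_convergence[where w = "\<lambda>u. norm (h u)"])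
    show "AE u in lborel. (\<lambda>n. norm (h u - indicator (S n) u *\<^sub>R h u)) \<longlonglongrightarrow> 0"
    proof (rule AE_I2)
      fix u
      have "eventually (\<lambda>n. norm (h u - indicator (S n) u *\<^sub>R h u) = 0) sequentially"
      proof (cases "r < u")
        case True
        have "eventually (\<lambda>n. r + 1 / (real n + 1) < u) sequentially"
          using True by real_asymp
        moreover have "eventually (\<lambda>n. u < r + 1 + real n) sequentially" by real_asymp
        ultimately show ?thesis by eventually_elim (auto simp: S_def)
      qed (simp add: h_def)
      then show "(\<lambda>n. norm (h u - indicator (S n) u *\<^sub>R h u)) \<longlonglongrightarrow> 0"
        by (rule tendsto_eventually)
    qed
    show "(\<lambda>u. norm (h u - indicator (S n) u *\<^sub>R h u)) \<in> borel_measurable lborel" for n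
      using hm unfolding S_def by measurable
  qed (use h in \<open>auto simp: indicator_def\<close>)
  then have "eventually (\<lambda>n. (LINT u|lborel. norm (h u - indicator (S n) u *\<^sub>R h u)) < e / 2) sequentially"
    using e by (intro order_tendstoD(2)[where y = 0]) auto
  then obtain n where n: "(LINT u|lborel. norm (h u - indicator (S n) u *\<^sub>R h u)) < e / 2"
    by (auto simp: eventually_sequentially)
  define a where "a = r + 1 / (real n + 1)"
  define b where "b = r + 1 + real n"
  have "1 / (real n + 1) \<le> 1 + real n" by (rule order_trans[of _ 1]) auto
  then have ab: "r < a" "a \<le> b" "S n = {a..b}" by (auto simp: a_def b_def S_def)
  then have gab: "continuous_on {a..b} g" by (intro continuous_on_subset[OF gc]) auto
  \<comment> \<open>The uniform error integrates to at most \<open>e / 4\<close>; the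
    \<open>+ 1\<close> keeps the denominator positive when \<open>a = b\<close>, which happens for
    \<open>n = 0\<close>. The budget is \<open>e / 2\<close> for the cut, \<open>e / 4\<close> here
    and \<open>e / 4\<close> for \<open>K / \<bar>y\<bar>\<close>.\<close>
  define q where "q = e / (4 * (b - a + 1))"
  have q: "q > 0" "q * (b - a) \<le> e / 4"
    using e ab by (auto simp: q_def field_simps)
  obtain p where p: "polynomial_function p" and pq: "\<And>u. u \<in> {a..b} \<Longrightarrow> norm (g u - p u) < q"
    using Stone_Weierstrass_polynomial_function[OF compact_Icc gab q(1)] by blast
  obtain p' where p': "polynomial_function p'" and pd: "\<And>u. (p has_vector_derivative p' u) (at u)"
    using has_vector_derivative_polynomial_function[OF p] by blast
  have pc: "continuous_on {a..b} p" and p'c: "continuous_on {a..b} p'"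
    using p p' by (auto intro: continuous_on_polymonial_function)
  have "bounded (p' ` {a..b})" by (intro compact_imp_bounded compact_continuous_image p'c compact_Icc)
  then obtain B where B: "\<And>u. u \<in> {a..b} \<Longrightarrow> norm (p' u) \<le> B"
    unfolding bounded_iff by blast
  define K where "K = norm (p a) + norm (p b) + B * (b - a)"
  have bound: "norm (LINT u:{r<..}|lborel. g u * cis (u * y)) \<le>
      (LINT u|lborel. norm (h u - indicator (S n) u *\<^sub>R h u)) + e / 4 + K / \<bar>y\<bar>" if y: "y \<noteq> 0" for y
  proof -
    have Sab: "set_integrable lborel {a..b} (\<lambda>u. g u * cis (u * y))"
      by (rule set_integrable_subset[OF set_integrable_mult_cis[OF g]]) (use ab in auto)
    have eq1: "(LINT u:{r<..}|lborel. g u * cis (u * y)) - integral {a..b} (\<lambda>u. g u * cis (u * y))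
        = (LINT u|lborel. indicator {r<..} u *\<^sub>R (g u * cis (u * y)) - indicator {a..b} u *\<^sub>R (g u * cis (u * y)))"
      using Sab set_integrable_mult_cis[OF g]
      unfolding set_borel_integral_eq_integral(2)[OF Sab, symmetric] set_lebesgue_integral_def set_integrable_def
      by (intro Bochner_Integration.integral_diff[symmetric]) auto
    have eq2: "(LINT u|lborel. norm (indicator {r<..} u *\<^sub>R (g u * cis (u * y)) - indicator {a..b} u *\<^sub>R (g u * cis (u * y))))
        = (LINT u|lborel. norm (h u - indicator (S n) u *\<^sub>R h u))"
      using ab by (intro Bochner_Integration.integral_cong) (auto simp: h_def indicator_def norm_mult)
    have 1: "norm ((LINT u:{r<..}|lborel. g u * cis (u * y)) - integral {a..b} (\<lambda>u. g u * cis (u * y)))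
        \<le> (LINT u|lborel. norm (h u - indicator (S n) u *\<^sub>R h u))"
      unfolding eq1 eq2[symmetric] by (rule integral_norm_bound)
    have "norm (integral {a..b} (\<lambda>u. (g u - p u) * cis (u * y))) \<le> q * (b - a)"
      by (rule integral_bound)
        (use ab pq in \<open>auto simp: norm_mult less_imp_le intro!: continuous_intros gab pc\<close>)
    moreover have "integral {a..b} (\<lambda>u. g u * cis (u * y)) =
        integral {a..b} (\<lambda>u. (g u - p u) * cis (u * y)) + integral {a..b} (\<lambda>u. p u * cis (u * y))"
      unfolding left_diff_distrib
      by (subst Henstock_Kurzweil_Integration.integral_diff)
        (auto intro!: integrable_continuous_real continuous_intros gab pc)
    moreover have "norm (integral {a..b} (\<lambda>u. p u * cis (u * y))) \<le> K / \<bar>y\<bar>"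
    proof -
      have "norm (integral {a..b} (\<lambda>u. p' u * cis (u * y))) \<le> B * (b - a)"
        by (rule integral_bound) (use ab B in \<open>auto simp: norm_mult intro!: continuous_intros p'c\<close>)
      then have "norm (p a * cis (a * y) - p b * cis (b * y) + integral {a..b} (\<lambda>u. p' u * cis (u * y))) \<le> K"
        using norm_triangle_ineq[of "p a * cis (a * y) - p b * cis (b * y)" "integral {a..b} (\<lambda>u. p' u * cis (u * y))"]
          norm_triangle_ineq4[of "p a * cis (a * y)" "p b * cis (b * y)"]
        by (simp add: K_def norm_mult)
      then show ?thesis
        unfolding integral_mult_cis_by_parts[OF ab(2) pc pd y]
        by (simp add: norm_mult norm_divide divide_right_mono)
    qed
    ultimately have 2: "norm (integral {a..b} (\<lambda>u. g u * cis (u * y))) \<le> e / 4 + K / \<bar>y\<bar>"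
      using q(2) norm_triangle_ineq[of "integral {a..b} (\<lambda>u. (g u - p u) * cis (u * y))" "integral {a..b} (\<lambda>u. p u * cis (u * y))"]
      by simp
    show ?thesis
      using 1 2 norm_triangle_sub[of "LINT u:{r<..}|lborel. g u * cis (u * y)" "integral {a..b} (\<lambda>u. g u * cis (u * y))"]
      by linarith
  qed
  show "eventually (\<lambda>y. dist (LINT u:{r<..}|lborel. g u * cis (u * y)) 0 < e) at_infinity"
    unfolding eventually_at_infinity
  proof (intro exI[of _ "4 * \<bar>K\<bar> / e + 1"] allI impI)
    fix y :: real assume y: "4 * \<bar>K\<bar> / e + 1 \<le> norm y"
    have "4 * \<bar>K\<bar> / e \<ge> 0" using e by simp
    then have y0: "\<bar>y\<bar> > 0" using y by simp
    have "4 * \<bar>K\<bar> / e < \<bar>y\<bar>" using y by simp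
    then have "K / \<bar>y\<bar> < e / 4" using e y0 by (simp add: field_simps abs_if split: if_splits)
    then show "dist (LINT u:{r<..}|lborel. g u * cis (u * y)) 0 < e"
      using bound[of y] y0 n unfolding dist_0_norm dist_commute[of _ 0] by linarith
  qed
qed

section \<open>Remainder of the payoff coefficients\<close>

text \<open>With no derivative to spare (\<open>n = 0\<close>) only the Riemann-Lebesgue lemma
  applies and there is no rate. Otherwise the bound for \<open>G 1\<close> and one further
  integration by parts give the rate \<open>1 / \<bar>y\<bar>\<close>, which also implies the limit
  0.\<close>

lemma oscillatory_integral_remainder:
  fixes G :: "nat \<Rightarrow> real \<Rightarrow> complex"
  assumes der: "\<And>j u. j < n \<Longrightarrow> u > r \<Longrightarrow> (G j has_vector_derivative G (Suc j) u) (at u)"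
    and lim: "\<And>j. j < n \<Longrightarrow> (G j \<longlongrightarrow> 0) at_top" and int: "set_integrable lborel {r<..} (G n)"
    and cont: "continuous_on {r<..} (G n)" and d: "d > 0"
  shows "\<exists>T. (\<forall>y. d \<le> \<bar>y\<bar> \<longrightarrow> ((\<lambda>R. integral {r..R} (\<lambda>u. G 0 u * cis (u * y))) \<longlongrightarrow> T y) at_top) \<and>
      (T \<longlongrightarrow> 0) at_infinity \<and> (n \<ge> 1 \<longrightarrow> (\<exists>C. \<forall>y. d \<le> \<bar>y\<bar> \<longrightarrow> norm (T y) \<le> C / \<bar>y\<bar>))"
proof (cases n)
  case 0
  then show ?thesis
    using int cont tendsto_integral_mult_cis_of_set_integrable[of r "G 0"] riemann_lebesgue_Ioi[of r "G 0"]
    by (intro exI[of _ "\<lambda>y. LINT u:{r<..}|lborel. G 0 u * cis (u * y)"]) auto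
next
  case (Suc k)
  have "(\<forall>b. G (Suc 0) integrable_on {r..b}) \<and> (\<exists>T C. \<forall>y. d \<le> \<bar>y\<bar> \<longrightarrow>
      ((\<lambda>R. integral {r..R} (\<lambda>u. G (Suc 0) u * cis (u * y))) \<longlongrightarrow> T y) at_top \<and> norm (T y) \<le> C)"
    by (rule oscillatory_integral_bounded[where G = "\<lambda>j. G (Suc j)" and n = k])
      (use Suc der lim int d in auto)
  then obtain T' C' where int': "\<And>b. G (Suc 0) integrable_on {r..b}"
    and T': "\<And>y. d \<le> \<bar>y\<bar> \<Longrightarrow> ((\<lambda>R. integral {r..R} (\<lambda>u. G (Suc 0) u * cis (u * y))) \<longlongrightarrow> T' y) at_top"
    and C': "\<And>y. d \<le> \<bar>y\<bar> \<Longrightarrow> norm (T' y) \<le> C'" by blast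
  have der0: "\<And>u. u > r \<Longrightarrow> (G 0 has_vector_derivative G (Suc 0) u) (at u)" and lim0: "(G 0 \<longlongrightarrow> 0) at_top"
    using der lim Suc by auto
  obtain T C where T: "\<And>y. d \<le> \<bar>y\<bar> \<Longrightarrow> ((\<lambda>R. integral {r..R} (\<lambda>u. G 0 u * cis (u * y))) \<longlongrightarrow> T y) at_top"
    and C: "\<And>y. d \<le> \<bar>y\<bar> \<Longrightarrow> norm (T y) \<le> C / \<bar>y\<bar>"
    using oscillatory_integral_decay_step(2)[OF der0 lim0 int' d T' C'] by blast
  have "(T \<longlongrightarrow> 0) at_infinity"
  proof (rule Lim_null_comparison)
    show "eventually (\<lambda>y. norm (T y) \<le> C / norm y) at_infinity"
      unfolding eventually_at_infinity using C by (intro exI[of _ d]) auto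
    show "((\<lambda>y::real. C / norm y) \<longlongrightarrow> 0) at_infinity"
      by (intro tendsto_divide_0[OF tendsto_const] filterlim_at_top_imp_at_infinity filterlim_norm_at_top)
  qed
  then show ?thesis using T C by blast
qed

text \<open>The truncated integral \<open>J r\<close> equals the inversion value
  \<open>pi * damped \<alpha> P y\<close> minus the real part of the tail \<open>E\<close>. The tail
  is evaluated by one integration by parts, leaving the oscillatory integral \<open>T\<close> of the
  derivative as the only unspecified quantity.\<close>

lemma payoff_coeff_bound:
  fixes r :: real
  assumes f: "integrable lborel (damped \<alpha> P)" and r: "r = 2 powr of_int m * pi"
    and F': "\<And>u. u > r \<Longrightarrow> (damped_hat \<alpha> P has_vector_derivative F' u) (at u)"
    and lim: "(damped_hat \<alpha> P \<longlongrightarrow> 0) at_top"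
    and T: "((\<lambda>R. integral {r..R} (\<lambda>u. F' u * cis (u * grid m k))) \<longlongrightarrow> T) at_top"
    and k: "k \<noteq> 0" and y: "\<not> jump_point P (grid m k)"
  shows "\<bar>payoff_coeff \<alpha> P m k\<bar>
    \<le> 2 powr (- of_int m / 2) * (\<bar>damped \<alpha> P (grid m k)\<bar> + eps_V \<alpha> P m * inverse \<bar>grid m k\<bar>)
      + 2 powr (- of_int m / 2) / pi * norm T * inverse \<bar>grid m k\<bar>"
proof -
  define y where "y = grid m k"
  define F where "F = damped_hat \<alpha> P"
  define J where "J R = integral {0..R} (\<lambda>u. Re (F u * cis (u * y)))" for R
  define E where "E = \<i> / of_real y * (F r * cis (r * y) + T)"
  have r0: "r > 0" by (simp add: r)
  have y0: "y \<noteq> 0" using k by (simp add: y_def grid_def)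
  have Fc: "continuous_on A F" for A
    unfolding F_def damped_hat_def by (rule continuous_on_fourier[OF f])
  \<comment> \<open>The transform of an integrable function is continuous everywhere, so the
    one-sided limit in the boundary term is the actual value \<open>F r\<close>, as
    \<open>eps_V\<close> demands.\<close>
  have "isCont F r" using Fc[of UNIV] by (simp add: continuous_on_eq_continuous_at)
  then have "(F \<longlongrightarrow> F r) (at_right r)"
    by (simp add: isCont_def filterlim_at_split)
  then have E: "((\<lambda>R. integral {r..R} (\<lambda>u. F u * cis (u * y))) \<longlongrightarrow> E) at_top"
    using F' lim T y0 unfolding F_def y_def E_def by (intro tendsto_integral_mult_cis_by_parts)
  have int: "(\<lambda>u. F u * cis (u * y)) integrable_on {a..b}" for a b
    by (intro integrable_continuous_real continuous_intros Fc)
  have "(J \<longlongrightarrow> J r + Re E) at_top"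
  proof (rule Lim_transform_eventually)
    show "((\<lambda>R. J r + Re (integral {r..R} (\<lambda>u. F u * cis (u * y)))) \<longlongrightarrow> J r + Re E) at_top"
      by (intro tendsto_intros E)
    show "eventually (\<lambda>R. J r + Re (integral {r..R} (\<lambda>u. F u * cis (u * y))) = J R) at_top"
      using eventually_ge_at_top[of r]
    proof eventually_elim
      case (elim R)
      have "Re (integral {r..R} (\<lambda>u. F u * cis (u * y))) = integral {r..R} (\<lambda>u. Re (F u * cis (u * y)))"
        using integral_linear[OF int bounded_linear_Re] by (simp add: o_def)
      moreover have "(\<lambda>u. Re (F u * cis (u * y))) integrable_on {0..R}"
        by (intro integrable_continuous_real continuous_intros Fc)
      ultimately show ?case
        unfolding J_def using r0 elim
        by (simp add: Henstock_Kurzweil_Integration.integral_combine del: times_complex.sel)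
    qed
  qed
  moreover have "isCont P y" using y by (simp add: y_def jump_point_def)
  then have "isCont (damped \<alpha> P) y"
    unfolding damped_def[abs_def] by (intro continuous_intros)
  ultimately have "J r + Re E = pi * damped \<alpha> P y"
    unfolding J_def F_def damped_hat_def by (intro fourier_inversion_of_convergent f)
  then have "J r = pi * damped \<alpha> P y - Re E" by linarith
  then have "payoff_coeff \<alpha> P m k = 2 powr (- of_int m / 2) / pi * (pi * damped \<alpha> P y - Re E)"
    unfolding payoff_coeff_eq_integral[OF f r] F_def[symmetric] y_def[symmetric] J_def[symmetric] by simp
  then have "\<bar>payoff_coeff \<alpha> P m k\<bar> = 2 powr (- of_int m / 2) / pi * \<bar>pi * damped \<alpha> P y - Re E\<bar>"
    by (simp add: abs_mult)
  also have "\<dots> \<le> 2 powr (- of_int m / 2) / pi *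
      (pi * \<bar>damped \<alpha> P y\<bar> + (\<bar>Im (F r)\<bar> + norm T) / \<bar>y\<bar>)"
  proof (intro mult_left_mono)
    \<comment> \<open>Hence \<open>cis (r * y)\<close> is 1 or -1. The prefactor
      \<open>\<i> / of_real y\<close> then exchanges real and imaginary parts, so that of
      \<open>F r\<close> only its imaginary part enters \<open>Re E\<close>.\<close>
    have ry: "r * y = pi * of_int k" by (simp add: r y_def grid_def)
    have "sin (r * y) = 0" "\<bar>cos (r * y)\<bar> = 1"
      unfolding ry using sin_int_times_real[of k] cos_int_times_real by (auto simp: mult.commute)
    then have "\<bar>Im (F r * cis (r * y))\<bar> = \<bar>Im (F r)\<bar>" by (simp add: abs_mult)
    moreover have "\<bar>Im T\<bar> \<le> norm T" by (rule abs_Im_le_cmod)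
    ultimately have "\<bar>Im (F r * cis (r * y) + T)\<bar> \<le> \<bar>Im (F r)\<bar> + norm T"
      unfolding plus_complex.sel by linarith
    moreover have "Re E = - Im (F r * cis (r * y) + T) / y"
      by (simp add: E_def Re_divide_of_real del: times_complex.sel(2))
    ultimately have "\<bar>Re E\<bar> \<le> (\<bar>Im (F r)\<bar> + norm T) / \<bar>y\<bar>"
      by (simp add: abs_divide divide_right_mono)
    then show "\<bar>pi * damped \<alpha> P y - Re E\<bar> \<le> pi * \<bar>damped \<alpha> P y\<bar> + (\<bar>Im (F r)\<bar> + norm T) / \<bar>y\<bar>"
      using abs_triangle_ineq4[of "pi * damped \<alpha> P y" "Re E"] by (simp add: abs_mult)
  qed simp
  also have "\<dots> = 2 powr (- of_int m / 2) * (\<bar>damped \<alpha> P y\<bar> + eps_V \<alpha> P m * inverse \<bar>y\<bar>)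
      + 2 powr (- of_int m / 2) / pi * norm T * inverse \<bar>y\<bar>"
    by (simp add: eps_V_def F_def r field_simps y0)
  finally show ?thesis by (simp add: y_def)
qed

lemma filterlim_grid_at_infinity: "filterlim (grid m) at_infinity cofinite"
  unfolding filterlim_at_infinity[OF order_refl] eventually_cofinite
proof (intro allI impI)
  fix B :: real
  show "finite {k. \<not> B \<le> norm (grid m k)}"
  proof (rule finite_subset)
    show "{k. \<not> B \<le> norm (grid m k)} \<subseteq> {- \<lceil>B * 2 powr of_int m\<rceil>..\<lceil>B * 2 powr of_int m\<rceil>}"
    proof
      fix k assume "k \<in> {k. \<not> B \<le> norm (grid m k)}"
      then have "\<bar>of_int k\<bar> < B * 2 powr of_int m"
        by (simp add: grid_def abs_divide field_simps)
      then show "k \<in> {- \<lceil>B * 2 powr of_int m\<rceil>..\<lceil>B * 2 powr of_int m\<rceil>}"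
        by (simp add: abs_less_iff) linarith
    qed
  qed simp
qed

text \<open>The negligible term is rendered in two ways. For \<open>N \<ge> 1\<close> it is
  \<open>C / (grid m k)\<^sup>2\<close> with one \<open>C\<close> for all \<open>k\<close>; for
  every \<open>N\<close>, including 0, it is little-o of \<open>1 / \<bar>grid m k\<bar>\<close> as
  \<open>k\<close> leaves finite sets. The last conjunct is the second expression for
  \<open>eps_V\<close>, through the transform of \<open>P\<close> at a shifted argument.\<close>

theorem corollary3p13:
  fixes m :: int and \<alpha> :: real and P :: "real \<Rightarrow> real" and N :: nat and r :: real
  assumes "admissible_payoff P"
    and "integrable lborel (damped \<alpha> P)"
    and "r = 2 powr of_int m * pi"
    and "Ck_on (N + 1) (damped_hat \<alpha> P) {u. \<bar>u\<bar> > r}"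
    and "\<And>j. j \<le> N \<Longrightarrow> (nth_deriv j (damped_hat \<alpha> P) \<longlongrightarrow> 0) at_infinity"
    and "set_integrable lborel {u. \<bar>u\<bar> > r} (nth_deriv (N + 1) (damped_hat \<alpha> P))"
  shows "(N \<ge> 1 \<longrightarrow>
           (\<exists>C. \<forall>k::int. k \<noteq> 0 \<and> \<not> jump_point P (grid m k) \<longrightarrow>
              \<bar>payoff_coeff \<alpha> P m k\<bar>
                \<le> 2 powr (- of_int m / 2) *
                    (\<bar>damped \<alpha> P (grid m k)\<bar> + eps_V \<alpha> P m * inverse \<bar>grid m k\<bar>)
                  + C * inverse ((grid m k)\<^sup>2)))
       \<and> (\<exists>R. R \<in> o[cofinite](\<lambda>k. inverse \<bar>grid m k\<bar>) \<and>
            (\<forall>k::int. k \<noteq> 0 \<and> \<not> jump_point P (grid m k) \<longrightarrow>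
              \<bar>payoff_coeff \<alpha> P m k\<bar>
                \<le> 2 powr (- of_int m / 2) *
                    (\<bar>damped \<alpha> P (grid m k)\<bar> + eps_V \<alpha> P m * inverse \<bar>grid m k\<bar>)
                  + R k))
       \<and> eps_V \<alpha> P m
           = \<bar>Im (fourier P (complex_of_real (2 powr of_int m * pi) - \<i> * complex_of_real \<alpha>))\<bar> / pi"
proof -
  define D where "D j = nth_deriv j (damped_hat \<alpha> P)" for j
  \<comment> \<open>The grid spacing, hence a lower bound for \<open>\<bar>grid m k\<bar>\<close>
    over all nonzero \<open>k\<close>: estimates uniform in \<open>\<bar>y\<bar> \<ge> d\<close>
    cover every admissible grid point.\<close>
  define d :: real where "d = 2 powr (- of_int m)"
  define c :: real where "c = 2 powr (- of_int m / 2) / pi"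
  have d: "d > 0" by (simp add: d_def)
  have c: "c > 0" by (simp add: c_def)
  have D0: "D 0 = damped_hat \<alpha> P" by (simp add: D_def nth_deriv_def)
  have sub: "{r<..} \<subseteq> {u. \<bar>u\<bar> > r}" by auto
  have der: "(D j has_vector_derivative D (Suc j) u) (at u)" if "j < N + 1" "u > r" for j u
  proof -
    have "D j differentiable (at u)"
      using assms(4) that by (auto simp: Ck_on_def D_def)
    moreover have "D (Suc j) u = vector_derivative (D j) (at u)"
      by (simp add: D_def nth_deriv_def)
    ultimately show ?thesis by (simp add: vector_derivative_works)
  qed
  have lim: "(D j \<longlongrightarrow> 0) at_top" if "j \<le> N" for j
    using tendsto_mono[OF at_top_le_at_infinity assms(5)[OF that]] by (simp add: D_def)
  have int: "set_integrable lborel {r<..} (D (Suc N))"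
    using set_integrable_subset[OF assms(6) _ sub] by (simp add: D_def)
  have cont: "continuous_on {r<..} (D (Suc N))"
    using assms(4) unfolding Ck_on_def D_def Suc_eq_plus1 by (auto intro: continuous_on_subset[OF _ sub])
  obtain T where T: "\<And>y. d \<le> \<bar>y\<bar> \<Longrightarrow>
      ((\<lambda>R. integral {r..R} (\<lambda>u. D 1 u * cis (u * y))) \<longlongrightarrow> T y) at_top"
    and T0: "(T \<longlongrightarrow> 0) at_infinity"
    and TC: "N \<ge> 1 \<longrightarrow> (\<exists>C. \<forall>y. d \<le> \<bar>y\<bar> \<longrightarrow> norm (T y) \<le> C / \<bar>y\<bar>)"
    \<comment> \<open>The family starts at the first derivative, since one integration by parts is
      spent on the boundary term with \<open>eps_V\<close>. This leaves \<open>N\<close> of the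
      \<open>N + 1\<close> derivatives.\<close>
    using oscillatory_integral_remainder[of N r "\<lambda>j. D (Suc j)" d] der lim int cont d by auto
  have dk: "d \<le> \<bar>grid m k\<bar>" if "k \<noteq> 0" for k
    using that by (simp add: d_def grid_def abs_divide powr_minus field_simps)
  have bound: "\<bar>payoff_coeff \<alpha> P m k\<bar>
      \<le> 2 powr (- of_int m / 2) * (\<bar>damped \<alpha> P (grid m k)\<bar> + eps_V \<alpha> P m * inverse \<bar>grid m k\<bar>)
        + c * norm (T (grid m k)) * inverse \<bar>grid m k\<bar>"
    if "k \<noteq> 0" "\<not> jump_point P (grid m k)" for k
    unfolding c_def
    by (rule payoff_coeff_bound[OF assms(2,3) _ _ T[OF dk] that])
      (use der[of 0] lim[of 0] that in \<open>auto simp: D0\<close>)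
  have quadratic: "\<exists>C. \<forall>k::int. k \<noteq> 0 \<and> \<not> jump_point P (grid m k) \<longrightarrow>
      \<bar>payoff_coeff \<alpha> P m k\<bar>
      \<le> 2 powr (- of_int m / 2) * (\<bar>damped \<alpha> P (grid m k)\<bar> + eps_V \<alpha> P m * inverse \<bar>grid m k\<bar>)
        + C * inverse ((grid m k)\<^sup>2)" if N: "N \<ge> 1"
  proof -
    obtain C where C: "\<And>y. d \<le> \<bar>y\<bar> \<Longrightarrow> norm (T y) \<le> C / \<bar>y\<bar>" using TC N by blast
    have "c * norm (T (grid m k)) * inverse \<bar>grid m k\<bar> \<le> c * C * inverse ((grid m k)\<^sup>2)" if "k \<noteq> 0" for k
    proof -
      have "c * norm (T (grid m k)) * inverse \<bar>grid m k\<bar> \<le> c * (C / \<bar>grid m k\<bar>) * inverse \<bar>grid m k\<bar>"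
        using c C[OF dk[OF that]] by (intro mult_right_mono mult_left_mono) auto
      also have "\<dots> = c * C * inverse (\<bar>grid m k\<bar>\<^sup>2)" by (simp add: power2_eq_square field_simps)
      finally show ?thesis by simp
    qed
    then show ?thesis using bound by (intro exI[of _ "c * C"]) (meson add_left_mono order_trans)
  qed
  have smallo: "(\<lambda>k. c * norm (T (grid m k)) * inverse \<bar>grid m k\<bar>) \<in> o[cofinite](\<lambda>k. inverse \<bar>grid m k\<bar>)"
  proof (rule smalloI_tendsto)
    \<comment> \<open>At \<open>k = 0\<close> the comparison function is
      \<open>inverse 0 = 0\<close>; the cofinite filter discards this point before the quotient is
      formed.\<close>
    have nz: "eventually (\<lambda>k::int. k \<noteq> 0) cofinite" by (simp add: eventually_cofinite)
    then show "eventually (\<lambda>k. inverse \<bar>grid m k\<bar> \<noteq> 0) cofinite"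
      by eventually_elim (simp add: grid_def)
    have lim0: "((\<lambda>k. c * norm (T (grid m k))) \<longlongrightarrow> 0) cofinite"
      by (intro tendsto_mult_right_zero tendsto_norm_zero filterlim_compose[OF T0 filterlim_grid_at_infinity])
    have "eventually (\<lambda>k. c * norm (T (grid m k))
        = c * norm (T (grid m k)) * inverse \<bar>grid m k\<bar> / inverse \<bar>grid m k\<bar>) cofinite"
      using nz by eventually_elim (simp add: grid_def)
    with lim0 show "((\<lambda>k. c * norm (T (grid m k)) * inverse \<bar>grid m k\<bar> / inverse \<bar>grid m k\<bar>) \<longlongrightarrow> 0) cofinite"
      by (rule Lim_transform_eventually)
  qed
  \<comment> \<open>The integrands agree pointwise, the damping factor being absorbed into the
    exponential, so the identity holds without moving a contour.\<close>
  have hat: "damped_hat \<alpha> P u = fourier P (complex_of_real u - \<i> * complex_of_real \<alpha>)" for u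
  proof -
    have "complex_of_real (damped \<alpha> P y) * exp (- (\<i> * complex_of_real u * complex_of_real y))
        = complex_of_real (P y) * exp (- (\<i> * (complex_of_real u - \<i> * complex_of_real \<alpha>) * complex_of_real y))" for y
    proof -
      have "- (\<i> * (complex_of_real u - \<i> * complex_of_real \<alpha>) * complex_of_real y)
          = complex_of_real (- \<alpha> * y) + - (\<i> * complex_of_real u * complex_of_real y)"
        by (simp add: algebra_simps)
      then have eq: "exp (- (\<i> * (complex_of_real u - \<i> * complex_of_real \<alpha>) * complex_of_real y))
          = complex_of_real (exp (- \<alpha> * y)) * exp (- (\<i> * complex_of_real u * complex_of_real y))"
        by (metis exp_add exp_of_real)
      show ?thesis unfolding eq damped_def of_real_mult by (simp only: mult_ac)
    qed
    then show ?thesis unfolding damped_hat_def fourier_def by simp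
  qed
  show ?thesis
  proof (intro conjI impI)
    show "\<exists>R. R \<in> o[cofinite](\<lambda>k. inverse \<bar>grid m k\<bar>) \<and>
        (\<forall>k::int. k \<noteq> 0 \<and> \<not> jump_point P (grid m k) \<longrightarrow>
          \<bar>payoff_coeff \<alpha> P m k\<bar>
            \<le> 2 powr (- of_int m / 2) *
                (\<bar>damped \<alpha> P (grid m k)\<bar> + eps_V \<alpha> P m * inverse \<bar>grid m k\<bar>)
              + R k)"
      using smallo bound
      by (intro exI[of _ "\<lambda>k. c * norm (T (grid m k)) * inverse \<bar>grid m k\<bar>"]) auto
  qed (use quadratic in \<open>simp_all add: eps_V_def hat\<close>)
qed

end
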